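(* Let $X\in\mathbb{R}^{n\times p}$ be deterministic, let $T\subset\{1,\dots,p\}$ be nonempty and assume that $\phi(1,T)>0$. Assume that the random noise $\varepsilon\in\mathbb{R}^n$ satisfies $\mathbb{E}[\varepsilon]=0$ and $\mathbb{E}[\|\varepsilon\|^2]<+\infty$. Let $\lambda>0$. If the Lasso estimator $$\hat\beta\in\operatorname{argmin}_{\beta\in\mathbb{R}^p}\bigl\{\|X\beta-y\|^2+2\sqrt n\,\lambda\|\beta\|_1\bigr\},\qquad y=X\beta^*+\varepsilon,$$ satisfies $$\sup_{\beta^*\in\mathbb{R}^p:\ \operatorname{supp}(\beta^* )\subset T}\mathbb{E}_{\beta^*}\bigl[\|X(\hat\beta-\beta^* )\|\bigr]\le C(T)\,\lambda\,|T|^{1/2}$$ for some constant $C(T)>0$ that may depend on $T$ but is independent of $\beta^*$, then $$\phi(1,T)^{-1}\le C(T).$$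
   Context: $\|\cdot\|$ is the Euclidean norm and $\|\cdot\|_1$ the $\ell_1$ norm. For $u\in\mathbb{R}^p$ and $S\subset\{1,\dots,p\}$, $u_S\in\mathbb{R}^p$ has coordinates $(u_S)_j=u_j$ if $j\in S$ and $0$ otherwise; $T^c=\{1,\dots,p\}\setminus T$. The compatibility constant (with constant $c_0=1$) is $$\phi(1,T)=\inf_{u\in\mathbb{R}^p:\ \|u_{T^c}\|_1<\|u_T\|_1}\frac{\sqrt{|T|}\,\|Xu\|}{\sqrt n\,(\|u_T\|_1-\|u_{T^c}\|_1)}.$$ $\mathbb{E}_{\beta^*}$ denotes expectation when $y=X\beta^*+\varepsilon$. *)

theory Defs
  imports "HOL-Probability.Probability"
begin

definition l1_norm :: "real ^ 'p \<Rightarrow> real" where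
  "l1_norm u = (\<Sum>j\<in>UNIV. \<bar>u $ j\<bar>)"

definition restrict_vec :: "real ^ 'p \<Rightarrow> 'p set \<Rightarrow> real ^ 'p" where
  "restrict_vec u S = (\<chi> j. if j \<in> S then u $ j else 0)"

definition supp_vec :: "real ^ 'p \<Rightarrow> 'p set" where
  "supp_vec u = {j. u $ j \<noteq> 0}"

(* The constant phi(1,T). For nonempty T the set below is nonempty and bounded below by 0,
   so the real-valued infimum is the actual one; for empty T its value is unspecified. *)
definition compat_const :: "real ^ 'p ^ 'n \<Rightarrow> 'p set \<Rightarrow> real" where
  "compat_const X T =
     (INF u \<in> {u. l1_norm (restrict_vec u (- T)) < l1_norm (restrict_vec u T)}.
        sqrt (real (card T)) * norm (X *v u) /
        (sqrt (real CARD('n)) * (l1_norm (restrict_vec u T) - l1_norm (restrict_vec u (- T)))))"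

definition lasso_objective :: "real ^ 'p ^ 'n \<Rightarrow> real \<Rightarrow> real ^ 'n \<Rightarrow> real ^ 'p \<Rightarrow> real" where
  "lasso_objective X lam y b =
     (norm (X *v b - y))\<^sup>2 + 2 * sqrt (real CARD('n)) * lam * l1_norm b"

(* The minimizer need not be unique, so a Lasso estimator is an arbitrary selection of a
   minimizer as a function of the data y; the selection is not required to be measurable. *)
definition lasso_estimator :: "real ^ 'p ^ 'n \<Rightarrow> real \<Rightarrow> (real ^ 'n \<Rightarrow> real ^ 'p) \<Rightarrow> bool" where
  "lasso_estimator X lam bhat \<longleftrightarrow>
     (\<forall>y. is_arg_min (lasso_objective X lam y) (\<lambda>b. True) (bhat y))"

end

(* The residual r = y - X bhat satisfies <Xb, r> \<le> sqrt n lam |b|_1 for all b, with equality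
   at b = bhat. Put b* = K u_T and h = bhat - b*. Compatibility keeps |bhat|_1 above |b*|_1 up to
   an error of order |Xh|, and |Xh| is bounded by |eps| plus a constant, so
   <X u_T, r> \<ge> sqrt n lam |u_T|_1 - O(1 + |eps|^2) / K. As r = eps - Xh, adding
   <X u_{T^c}, r> \<ge> - sqrt n lam |u_{T^c}|_1 and taking expectations bounds
   |Xu| E|Xh| from below by sqrt n lam (|u_T|_1 - |u_{T^c}|_1) - O(1/K). Let K tend to infinity.
   Uniqueness of the minimizer is never needed: the argument works with X bhat only. *)
theory Submission
  imports Defs
begin

lemma l1_norm_nonneg [simp]: "0 \<le> l1_norm u"
  by (simp add: l1_norm_def sum_nonneg)

lemma l1_norm_triangle: "l1_norm (u + v) \<le> l1_norm u + l1_norm v"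
  unfolding l1_norm_def sum.distrib[symmetric] by (rule sum_mono) (simp add: abs_triangle_ineq)

lemma l1_norm_scaleR: "l1_norm (a *\<^sub>R u) = \<bar>a\<bar> * l1_norm u"
  by (simp add: l1_norm_def sum_distrib_left abs_mult)

lemma l1_norm_zero [simp]: "l1_norm 0 = 0"
  by (simp add: l1_norm_def)

lemma l1_norm_minus [simp]: "l1_norm (- u) = l1_norm u"
  by (simp add: l1_norm_def)

lemma restrict_vec_add_Compl: "restrict_vec u T + restrict_vec u (- T) = u"
  by (simp add: restrict_vec_def vec_eq_iff)

lemma supp_scaleR_restrict_vec: "supp_vec (a *\<^sub>R restrict_vec u T) \<subseteq> T"
  by (auto simp: supp_vec_def restrict_vec_def)

text \<open>Coordinatewise: on \<open>T\<close> this is the reverse triangle inequality, and off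
  \<open>T\<close> the entry of \<open>b\<close> vanishes, so \<open>b + h\<close> keeps the full
  size of \<open>h\<close> there.\<close>

lemma l1_norm_add_supported_ge:
  assumes "supp_vec b \<subseteq> T"
  shows "l1_norm b - (l1_norm (restrict_vec h T) - l1_norm (restrict_vec h (- T))) \<le> l1_norm (b + h)"
proof -
  have "l1_norm b - (l1_norm (restrict_vec h T) - l1_norm (restrict_vec h (- T)))
    = (\<Sum>j\<in>UNIV. \<bar>b $ j\<bar> - \<bar>restrict_vec h T $ j\<bar> + \<bar>restrict_vec h (- T) $ j\<bar>)"
    by (simp add: l1_norm_def sum.distrib sum_subtractf)
  also have "\<dots> \<le> (\<Sum>j\<in>UNIV. \<bar>(b + h) $ j\<bar>)"
  proof (rule sum_mono)
    fix j
    have "j \<in> T \<or> b $ j = 0"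
      using assms by (auto simp: supp_vec_def)
    then show "\<bar>b $ j\<bar> - \<bar>restrict_vec h T $ j\<bar> + \<bar>restrict_vec h (- T) $ j\<bar> \<le> \<bar>(b + h) $ j\<bar>"
      by (auto simp: restrict_vec_def)
  qed
  finally show ?thesis by (simp add: l1_norm_def)
qed

text \<open>Clearing the denominator gives a bound for every \<open>h\<close>: inside the cone it
  comes from the defining infimum, outside the cone the left side is nonpositive.\<close>

lemma compat_const_bound:
  fixes X :: "real ^ 'p ^ 'n"
  assumes "0 < compat_const X T"
  shows "compat_const X T * sqrt (real CARD('n)) * (l1_norm (restrict_vec h T) - l1_norm (restrict_vec h (- T)))
    \<le> sqrt (real (card T)) * norm (X *v h)"
proof (cases "l1_norm (restrict_vec h (- T)) < l1_norm (restrict_vec h T)")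
  case True
  let ?gap = "l1_norm (restrict_vec h T) - l1_norm (restrict_vec h (- T))"
  have "compat_const X T \<le> sqrt (real (card T)) * norm (X *v h) / (sqrt (real CARD('n)) * ?gap)"
    unfolding compat_const_def
    by (rule cINF_lower, rule bdd_belowI2[of _ 0]) (use True in \<open>auto intro!: divide_nonneg_nonneg mult_nonneg_nonneg\<close>)
  moreover have "0 < sqrt (real CARD('n)) * ?gap"
    using True by simp
  ultimately show ?thesis
    by (simp add: pos_le_divide_eq mult.assoc)
next
  case False
  then have "compat_const X T * sqrt (real CARD('n)) * (l1_norm (restrict_vec h T) - l1_norm (restrict_vec h (- T))) \<le> 0"
    using assms by (intro mult_nonneg_nonpos) auto
  then show ?thesis
    by (rule order_trans) simp
qed

text \<open>Convexity of \<open>l1_norm\<close> replaces subdifferential calculus: \<open>bh\<close>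
  is compared with points of the segment from \<open>bh\<close> to \<open>b\<close> that approach
  \<open>bh\<close>.\<close>

lemma lasso_variational_inequality:
  fixes X :: "real ^ 'p ^ 'n"
  assumes min: "\<And>b. lasso_objective X lam y bh \<le> lasso_objective X lam y b"
    and "0 \<le> lam"
  shows "(X *v (b - bh)) \<bullet> (y - X *v bh) \<le> sqrt (real CARD('n)) * lam * (l1_norm b - l1_norm bh)"
proof -
  define d where "d = X *v (b - bh)"
  define r where "r = y - X *v bh"
  define L where "L = sqrt (real CARD('n)) * lam"
  have L: "0 \<le> L" using assms by (simp add: L_def)
  \<comment> \<open>Dividing the comparison at \<open>bh + t *\<^sub>R (b - bh)\<close> by
    \<open>2 * t\<close> leaves only the quadratic remainder, which is now linear in
    \<open>t\<close>.\<close>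
  have bound: "d \<bullet> r - L * (l1_norm b - l1_norm bh) \<le> t * ((norm d)\<^sup>2 / 2)" if t: "0 < t" "t < 1" for t
  proof -
    have "X *v (bh + t *\<^sub>R (b - bh)) - y = t *\<^sub>R d - r"
      by (simp add: d_def r_def matrix_vector_right_distrib matrix_vector_mult_scaleR)
    then have quad: "(norm (X *v (bh + t *\<^sub>R (b - bh)) - y))\<^sup>2 = t\<^sup>2 * (norm d)\<^sup>2 - 2 * t * (d \<bullet> r) + (norm r)\<^sup>2"
      by (simp only: power2_norm_eq_inner inner_diff) (simp add: inner_commute power2_eq_square)
    have "bh + t *\<^sub>R (b - bh) = (1 - t) *\<^sub>R bh + t *\<^sub>R b"
      by (simp add: algebra_simps)
    then have "l1_norm (bh + t *\<^sub>R (b - bh)) \<le> (1 - t) * l1_norm bh + t * l1_norm b"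
      using l1_norm_triangle[of "(1 - t) *\<^sub>R bh" "t *\<^sub>R b"] t by (simp add: l1_norm_scaleR)
    then have "2 * L * l1_norm (bh + t *\<^sub>R (b - bh)) \<le> 2 * L * ((1 - t) * l1_norm bh + t * l1_norm b)"
      using L by (intro mult_left_mono) auto
    moreover have "(norm r)\<^sup>2 + 2 * L * l1_norm bh
        \<le> t\<^sup>2 * (norm d)\<^sup>2 - 2 * t * (d \<bullet> r) + (norm r)\<^sup>2 + 2 * L * l1_norm (bh + t *\<^sub>R (b - bh))"
      using min[of "bh + t *\<^sub>R (b - bh)"] quad
      by (simp add: lasso_objective_def L_def r_def norm_minus_commute mult.assoc)
    ultimately have "2 * t * (d \<bullet> r - L * (l1_norm b - l1_norm bh)) \<le> 2 * t * (t * ((norm d)\<^sup>2 / 2))"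
      by (simp add: algebra_simps power2_eq_square)
    then show ?thesis
      using t by simp
  qed
  have "((\<lambda>t. t * ((norm d)\<^sup>2 / 2)) \<longlongrightarrow> 0 * ((norm d)\<^sup>2 / 2)) (at_right 0)"
    by (intro tendsto_intros)
  moreover have "\<forall>\<^sub>F t in at_right (0::real). d \<bullet> r - L * (l1_norm b - l1_norm bh) \<le> t * ((norm d)\<^sup>2 / 2)"
    using bound by (auto simp: eventually_at_right_field intro!: exI[of _ 1])
  ultimately have "d \<bullet> r - L * (l1_norm b - l1_norm bh) \<le> 0 * ((norm d)\<^sup>2 / 2)"
    by (rule tendsto_lowerbound) simp
  then show ?thesis
    by (simp add: d_def r_def L_def)
qed

text \<open>A deterministic inequality for one fixed noise vector \<open>e\<close>. The constant
  \<open>c\<close> is chosen so that compatibility costs at most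
  \<open>c * norm (X *v (bh - bs))\<close>; the term linear in \<open>e\<close> is kept as it is
  because it vanishes in expectation for centred noise.\<close>

lemma lasso_loss_lower_bound:
  fixes X :: "real ^ 'p ^ 'n" and e :: "real ^ 'n"
  assumes min: "\<And>b. lasso_objective X lam (X *v bs + e) bh \<le> lasso_objective X lam (X *v bs + e) b"
    and lam: "0 < lam" and K: "0 < K"
    and bs: "bs = K *\<^sub>R restrict_vec u T"
    and compat: "0 < compat_const X T"
    and c: "c = lam * sqrt (real (card T)) / compat_const X T"
  shows "sqrt (real CARD('n)) * lam * (l1_norm (restrict_vec u T) - l1_norm (restrict_vec u (- T)))
      - (2 * (norm e)\<^sup>2 + 2 * c\<^sup>2) / K - (X *v u) \<bullet> e
    \<le> norm (X *v u) * norm (X *v (bh - bs))"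
proof -
  define L where "L = sqrt (real CARD('n)) * lam"
  define h where "h = bh - bs"
  define r where "r = e - X *v h"
  have L: "0 \<le> L" using lam by (simp add: L_def)
  have r: "X *v bs + e - X *v bh = r"
    by (simp add: r_def h_def matrix_vector_mult_diff_distrib)
  have vi: "(X *v (b - bh)) \<bullet> r \<le> L * (l1_norm b - l1_norm bh)" for b
    using lasso_variational_inequality[OF min, of b] lam r by (simp add: L_def)
  \<comment> \<open>The competitor \<open>b + bh\<close> turns optimality into dual feasibility of
    \<open>r\<close>.\<close>
  have dual: "(X *v b) \<bullet> r \<le> L * l1_norm b" for b
  proof -
    have "(X *v b) \<bullet> r \<le> L * (l1_norm (b + bh) - l1_norm bh)"
      using vi[of "b + bh"] by simp
    also have "\<dots> \<le> L * l1_norm b"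
      using l1_norm_triangle[of b bh] L by (intro mult_left_mono) auto
    finally show ?thesis .
  qed
  \<comment> \<open>The competitor 0 gives the converse inequality at \<open>bh\<close>.\<close>
  have dual_eq: "L * l1_norm bh \<le> (X *v bh) \<bullet> r"
    using vi[of 0] by (simp only: matrix_vector_mult_diff_distrib inner_diff_left) simp
  have c0: "0 \<le> c"
    using c lam compat by simp
  have compat': "L * (l1_norm (restrict_vec h T) - l1_norm (restrict_vec h (- T))) \<le> c * norm (X *v h)"
    using mult_left_mono[OF compat_const_bound[OF compat, of h], of lam] lam compat
    by (simp add: c L_def field_simps)
  have supp: "supp_vec bs \<subseteq> T"
    by (simp add: bs supp_scaleR_restrict_vec)
  have "L * (l1_norm bs - (l1_norm (restrict_vec h T) - l1_norm (restrict_vec h (- T)))) \<le> L * l1_norm bh"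
    using l1_norm_add_supported_ge[OF supp, of h] L by (intro mult_left_mono) (auto simp: h_def)
  with compat' have shrink: "L * l1_norm bs - c * norm (X *v h) \<le> L * l1_norm bh"
    by (simp add: algebra_simps)
  have eh: "(X *v h) \<bullet> e \<le> norm e * norm (X *v h)"
    using norm_cauchy_schwarz[of "X *v h" e] by (simp add: mult.commute)
  \<comment> \<open>The competitor \<open>bs\<close> bounds the loss; its square appears through
    \<open>r = e - X *v h\<close>.\<close>
  have "- ((X *v h) \<bullet> r) \<le> L * (l1_norm bs - l1_norm bh)"
    using vi[of bs] by (simp add: h_def matrix_vector_mult_diff_distrib inner_diff_left)
  then have "norm (X *v h) * norm (X *v h) \<le> norm (X *v h) * (norm e + c)"
    using shrink eh
    by (simp add: r_def inner_diff_right dot_square_norm power2_eq_square algebra_simps)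
  then have Xh: "norm (X *v h) \<le> norm e + c"
    using c0 by (cases "norm (X *v h) = 0") (auto simp del: norm_eq_zero simp add: mult_le_cancel_left)
  have "(X *v h) \<bullet> r \<le> norm e * norm (X *v h)"
    using eh inner_ge_zero[of "X *v h"] unfolding r_def inner_diff_right by linarith
  \<comment> \<open>The errors from noise and compatibility are absorbed into a bound free of
    \<open>h\<close> and quadratic in \<open>norm e\<close>, so the second moment of the noise
    controls it.\<close>
  moreover have "norm e * norm (X *v h) + c * norm (X *v h) \<le> (norm e + c)\<^sup>2"
    using mult_left_mono[OF Xh, of "norm e + c"] c0 by (simp add: power2_eq_square algebra_simps)
  moreover have "(norm e + c)\<^sup>2 \<le> 2 * (norm e)\<^sup>2 + 2 * c\<^sup>2"
    using zero_le_power2[of "norm e - c"] by (simp add: power2_eq_square algebra_simps)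
  moreover have "(X *v bs) \<bullet> r = (X *v bh) \<bullet> r - (X *v h) \<bullet> r"
    by (simp add: h_def matrix_vector_mult_diff_distrib inner_diff_left)
  ultimately have "L * l1_norm bs - (2 * (norm e)\<^sup>2 + 2 * c\<^sup>2) \<le> (X *v bs) \<bullet> r"
    using dual_eq shrink by linarith
  then have "K * (L * l1_norm (restrict_vec u T)) - (2 * (norm e)\<^sup>2 + 2 * c\<^sup>2)
      \<le> K * ((X *v restrict_vec u T) \<bullet> r)"
    using K by (simp add: bs l1_norm_scaleR matrix_vector_mult_scaleR algebra_simps)
  \<comment> \<open>Neither \<open>e\<close> nor \<open>c\<close> depends on \<open>K\<close>, so
    dividing by \<open>K\<close> makes the error small for large \<open>K\<close>.\<close>
  then have on_T: "L * l1_norm (restrict_vec u T) - (2 * (norm e)\<^sup>2 + 2 * c\<^sup>2) / K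
      \<le> (X *v restrict_vec u T) \<bullet> r"
    using K by (simp add: field_simps)
  have off_T: "- (L * l1_norm (restrict_vec u (- T))) \<le> (X *v restrict_vec u (- T)) \<bullet> r"
    using dual[of "0 - restrict_vec u (- T)"]
    by (simp only: matrix_vector_mult_diff_distrib inner_diff_left) simp
  have "(X *v u) \<bullet> r = (X *v restrict_vec u T) \<bullet> r + (X *v restrict_vec u (- T)) \<bullet> r"
    by (metis restrict_vec_add_Compl matrix_vector_right_distrib inner_add_left)
  moreover have "(X *v u) \<bullet> r \<le> (X *v u) \<bullet> e + norm (X *v u) * norm (X *v h)"
    using norm_cauchy_schwarz[of "- (X *v u)" "X *v h"] by (simp add: r_def inner_diff_right)
  ultimately show ?thesis
    using on_T off_T unfolding h_def[symmetric] L_def[symmetric] by (simp add: algebra_simps)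
qed

(* f need not be measurable: nn_integral is a lower integral, hence still monotone. *)
lemma integral_le_of_nn_integral_le:
  fixes f g :: "'w \<Rightarrow> real"
  assumes g: "integrable M g" and le: "\<And>w. g w \<le> f w" and f: "\<And>w. 0 \<le> f w"
    and bound: "(\<integral>\<^sup>+ w. ennreal (f w) \<partial>M) \<le> ennreal D" and D: "0 \<le> D"
  shows "integral\<^sup>L M g \<le> D"
proof -
  \<comment> \<open>\<open>ennreal\<close> sends negative reals to 0, so the comparison is made with
    the positive part of \<open>g\<close>, which \<open>f\<close> still dominates.\<close>
  have g': "integrable M (\<lambda>w. max 0 (g w))"
    using g by simp
  have "ennreal (\<integral>w. max 0 (g w) \<partial>M) = (\<integral>\<^sup>+ w. ennreal (max 0 (g w)) \<partial>M)"
    by (rule nn_integral_eq_integral[symmetric, OF g']) simp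
  also have "\<dots> \<le> (\<integral>\<^sup>+ w. ennreal (f w) \<partial>M)"
    using le f by (intro nn_integral_mono ennreal_leI) simp
  also note bound
  finally have "(\<integral>w. max 0 (g w) \<partial>M) \<le> D"
    using D by simp
  moreover have "integral\<^sup>L M g \<le> (\<integral>w. max 0 (g w) \<partial>M)"
    by (rule integral_mono[OF g g']) simp
  ultimately show ?thesis by simp
qed

theorem theorem3p2:
  fixes X :: "real ^ 'p ^ 'n"
    and T :: "'p set"
    and M :: "'w measure"
    and eps :: "'w \<Rightarrow> real ^ 'n"
    and lam C :: real
    and bhat :: "real ^ 'n \<Rightarrow> real ^ 'p"
  assumes T_nonempty: "T \<noteq> {}"
    and compat_pos: "compat_const X T > 0"
    and prob: "prob_space M"
    and eps_measurable: "eps \<in> borel_measurable M"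
    and eps_square_integrable: "integrable M (\<lambda>w. (norm (eps w))\<^sup>2)"
    and eps_mean_zero: "(LINT w|M. eps w) = 0"
    and lam_pos: "lam > 0"
    and lasso: "lasso_estimator X lam bhat"
    and C_pos: "C > 0"
    and risk_bound:
      "(SUP bstar \<in> {b. supp_vec b \<subseteq> T}.
          \<integral>\<^sup>+ w. ennreal (norm (X *v (bhat (X *v bstar + eps w) - bstar))) \<partial>M)
        \<le> ennreal (C * lam * sqrt (real (card T)))"
  shows "inverse (compat_const X T) \<le> C"
proof -
  interpret prob_space M by (fact prob)
  define \<phi> where "\<phi> = compat_const X T"
  define c where "c = lam * sqrt (real (card T)) / \<phi>"
  define B where "B = 2 * (\<integral>w. (norm (eps w))\<^sup>2 \<partial>M) + 2 * c\<^sup>2"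
  define D where "D = C * lam * sqrt (real (card T))"
  have D: "0 \<le> D" using C_pos lam_pos by (simp add: D_def)
  have card_T: "0 < card T"
    using T_nonempty by (simp add: card_gt_0_iff)
  have eps_integrable: "integrable M eps"
  proof (rule Bochner_Integration.integrable_bound)
    show "integrable M (\<lambda>w. 1 + (norm (eps w))\<^sup>2)"
      using eps_square_integrable by simp
    have "t \<le> 1 + t\<^sup>2" for t :: real
      using zero_le_power2[of "t - 1 / 2"] by (simp add: power2_eq_square algebra_simps)
    then show "AE w in M. norm (eps w) \<le> norm (1 + (norm (eps w))\<^sup>2)"
      by simp
  qed (fact eps_measurable)
  have min: "lasso_objective X lam y (bhat y) \<le> lasso_objective X lam y b" for y b
    using lasso by (simp add: lasso_estimator_def is_arg_min_linorder)

  \<comment> \<open>In this reciprocal form it suffices to bound the quotient from below for each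
    single \<open>u\<close> of the cone.\<close>
  have "inverse C \<le> compat_const X T"
    unfolding compat_const_def
  proof (rule cINF_greatest)
    \<comment> \<open>A coordinate vector with index in \<open>T\<close> lies in the cone.\<close>
    obtain j where "j \<in> T" using T_nonempty by blast
    have "l1_norm (restrict_vec (axis j 1) (- T) :: real ^ 'p) = 0"
      using \<open>j \<in> T\<close> by (auto simp: l1_norm_def restrict_vec_def axis_def intro!: sum.neutral)
    moreover have "l1_norm (restrict_vec (axis j 1) T :: real ^ 'p) = (\<Sum>i\<in>UNIV. if i = j then 1 else 0)"
      unfolding l1_norm_def using \<open>j \<in> T\<close> by (intro sum.cong) (auto simp: restrict_vec_def axis_def)
    ultimately have "(axis j 1 :: real ^ 'p) \<in> {u. l1_norm (restrict_vec u (- T)) < l1_norm (restrict_vec u T)}"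
      by simp
    then show "{u :: real ^ 'p. l1_norm (restrict_vec u (- T)) < l1_norm (restrict_vec u T)} \<noteq> {}"
      by blast
  next
    fix u :: "real ^ 'p"
    assume "u \<in> {u. l1_norm (restrict_vec u (- T)) < l1_norm (restrict_vec u T)}"
    define gap where "gap = l1_norm (restrict_vec u T) - l1_norm (restrict_vec u (- T))"
    have gap: "0 < gap"
      using \<open>u \<in> _\<close> by (simp add: gap_def)
    \<comment> \<open>Positivity of the compatibility constant excludes \<open>X *v u = 0\<close> on
      the cone, which permits division by \<open>norm (X *v u)\<close>.\<close>
    have "0 < \<phi> * sqrt (real CARD('n)) * gap"
      using gap compat_pos by (simp add: \<phi>_def)
    also have "\<dots> \<le> sqrt (real (card T)) * norm (X *v u)"
      using compat_const_bound[OF compat_pos, of u] by (simp add: \<phi>_def gap_def)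
    finally have Xu: "0 < norm (X *v u)"
      using card_T by (simp add: zero_less_mult_iff)
    have step: "sqrt (real CARD('n)) * lam * gap - B / K \<le> norm (X *v u) * D" if K: "0 < K" for K
    proof -
      define bs where "bs = K *\<^sub>R restrict_vec u T"
      define g where "g w = sqrt (real CARD('n)) * lam * gap
        - (2 * (norm (eps w))\<^sup>2 + 2 * c\<^sup>2) / K - (X *v u) \<bullet> eps w" for w
      have g: "integrable M g"
        unfolding g_def using eps_integrable eps_square_integrable by simp
      have "integral\<^sup>L M g = sqrt (real CARD('n)) * lam * gap - B / K"
        unfolding g_def B_def using eps_integrable eps_square_integrable eps_mean_zero
        by (simp add: prob_space)
      \<comment> \<open>Only the integrable minorant is integrated as a real function; the loss
        itself enters through its \<open>nn_integral\<close>.\<close>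
      moreover have "(\<integral>w. g w / norm (X *v u) \<partial>M) \<le> D"
      proof (rule integral_le_of_nn_integral_le)
        show "integrable M (\<lambda>w. g w / norm (X *v u))"
          using g by simp
        show "g w / norm (X *v u) \<le> norm (X *v (bhat (X *v bs + eps w) - bs))" for w
          using lasso_loss_lower_bound[OF min lam_pos K bs_def compat_pos c_def[unfolded \<phi>_def]] Xu
          by (simp add: g_def gap_def pos_divide_le_eq mult.commute)
        \<comment> \<open>The vector \<open>bs\<close> is supported in \<open>T\<close> for every
          \<open>K\<close>, so the same \<open>D\<close> serves all \<open>K\<close>.\<close>
        have "(\<integral>\<^sup>+ w. ennreal (norm (X *v (bhat (X *v bs + eps w) - bs))) \<partial>M)
          \<le> (SUP bstar \<in> {b. supp_vec b \<subseteq> T}.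
              \<integral>\<^sup>+ w. ennreal (norm (X *v (bhat (X *v bstar + eps w) - bstar))) \<partial>M)"
          by (rule SUP_upper) (simp add: bs_def supp_scaleR_restrict_vec)
        also note risk_bound
        finally show "(\<integral>\<^sup>+ w. ennreal (norm (X *v (bhat (X *v bs + eps w) - bs))) \<partial>M) \<le> ennreal D"
          by (simp add: D_def)
      qed (use D in auto)
      ultimately show ?thesis
        using Xu by (simp add: pos_divide_le_eq mult.commute)
    qed
    \<comment> \<open>\<open>B\<close> does not depend on \<open>K\<close>, so the error term
      disappears in the limit.\<close>
    have "((\<lambda>K. sqrt (real CARD('n)) * lam * gap - B / K) \<longlongrightarrow> sqrt (real CARD('n)) * lam * gap - 0) at_top"
      by (intro tendsto_intros tendsto_divide_0[OF tendsto_const] filterlim_at_top_imp_at_infinity filterlim_ident)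
    moreover have "\<forall>\<^sub>F K in at_top. sqrt (real CARD('n)) * lam * gap - B / K \<le> norm (X *v u) * D"
      using eventually_gt_at_top[of 0] by eventually_elim (rule step)
    ultimately have "sqrt (real CARD('n)) * lam * gap - 0 \<le> norm (X *v u) * D"
      by (rule tendsto_upperbound) simp
    then have "lam * (sqrt (real CARD('n)) * gap) \<le> lam * (C * (sqrt (real (card T)) * norm (X *v u)))"
      by (simp add: D_def algebra_simps)
    then have "sqrt (real CARD('n)) * gap \<le> C * (sqrt (real (card T)) * norm (X *v u))"
      using lam_pos by simp
    then show "inverse C \<le> sqrt (real (card T)) * norm (X *v u) /
        (sqrt (real CARD('n)) * (l1_norm (restrict_vec u T) - l1_norm (restrict_vec u (- T))))"
      using gap C_pos unfolding gap_def[symmetric] by (simp add: field_simps)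
  qed
  then show ?thesis
    using C_pos compat_pos le_imp_inverse_le[of "inverse C" "compat_const X T"] by simp
qed

end
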